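(* Let $(X,d)$ be a complete metric space, let $Y$ be a (real, Hausdorff) topological vector space, let $D\subset Y$ be a closed convex cone, let $H\subset D$ be a $\sigma$-convex set such that $0\notin\mathrm{vcl}(H+D)$, and let $f:X\to Y$ be a map which is submonotone with respect to $D$. Suppose that $x_0\in X$ and $\epsilon>0$ are such that $$(f(x_0)-\epsilon H-D)\cap f(X)=\emptyset.$$ Then, for any $\gamma>0$, there exists $\hat{x}\in X$ such that (a) $f(x_0)\in f(\hat{x})+\gamma d(x_0,\hat{x})H+D$; (b) $d(x_0,\hat{x})<\epsilon/\gamma$; (c) for all $x\in X\setminus\{\hat{x}\}$, $f(\hat{x})\notin f(x)+\gamma d(\hat{x},x)H+D$.
   Context: A convex cone is a nonempty set $D\subset Y$ with $D+D\subset D$ and $\alpha D\subset D$ for all $\alpha\ge0$; it defines the quasi-order $y_1\le_D y_2\iff y_1-y_2\in-D$. Sums and scalar multiples of sets are elementwise. A nonempty set $B\subset Y$ is $\sigma$-convex if every series $\sum_{n=1}^\infty\lambda_n b_n$ with all $b_n\in B$, all $\lambda_n\ge0$ and $\sum_{n=1}^\infty\lambda_n=1$ converges to a point of $B$. The vector closure of $A\subset Y$ is $$\mathrm{vcl}(A)=\{y\in Y:\ \exists v\in Y,\ \exists\lambda_n\ge0,\ \lambda_n\to0 \text{ such that } y+\lambda_n v\in A\ \forall n\in\mathbb{N}\}.$$ The map $f:X\to Y$ is (sequentially) submonotone with respect to $D$ if for every $x\in X$ and every sequence $(x_n)$ in $X$ with $x_n\to x$ and $f(x_m)\le_D f(x_n)$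 for all $m>n$, one has $f(x)\le_D f(x_n)$ for all $n$. *)

theory Defs
  imports "HOL-Analysis.Analysis" "HOL-Library.Set_Algebras"
begin

text \<open>
  Real topological vector spaces, not assumed Hausdorff: joint continuity of addition comes
  from \<^class>\<open>topological_ab_group_add\<close>, joint continuity of scalar multiplication is
  stated in the same style as the library states it for addition.
\<close>

class real_topological_vector_space = real_vector + topological_ab_group_add +
  assumes tendsto_scaleR_Pair:
    "LIM p (nhds c \<times>\<^sub>F nhds y). fst p *\<^sub>R snd p :> nhds (c *\<^sub>R y)"

instance real_normed_vector \<subseteq> real_topological_vector_space
  by standard
    (intro tendsto_scaleR filterlim_fst filterlim_snd)

definition sigma_convex :: "'a::{real_vector, topological_space} set \<Rightarrow> bool" where
  "sigma_convex B \<longleftrightarrow> B \<noteq> {} \<and>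
    (\<forall>(b :: nat \<Rightarrow> 'a) l. (\<forall>n. b n \<in> B) \<and> (\<forall>n. 0 \<le> l n) \<and> l sums 1 \<longrightarrow>
       (\<exists>y\<in>B. (\<lambda>n. l n *\<^sub>R b n) sums y))"

text \<open>The vector closure is purely algebraic: the only limit taken is that of real numbers.\<close>

definition vcl :: "'a::real_vector set \<Rightarrow> 'a set" where
  "vcl A = {y. \<exists>v. \<exists>l :: nat \<Rightarrow> real.
     (\<forall>n. 0 \<le> l n) \<and> l \<longlonglongrightarrow> 0 \<and> (\<forall>n. y + l n *\<^sub>R v \<in> A)}"

definition cone_le :: "'a::real_vector set \<Rightarrow> 'a \<Rightarrow> 'a \<Rightarrow> bool" where
  "cone_le D y1 y2 \<longleftrightarrow> y1 - y2 \<in> uminus ` D"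

definition submonotone :: "'b::real_vector set \<Rightarrow> ('a::topological_space \<Rightarrow> 'b) \<Rightarrow> bool" where
  "submonotone D f \<longleftrightarrow>
    (\<forall>x s. s \<longlonglongrightarrow> x \<and> (\<forall>m n. n < m \<longrightarrow> cone_le D (f (s m)) (f (s n))) \<longrightarrow>
       (\<forall>n. cone_le D (f x) (f (s n))))"

end

theory Submission
  imports Defs
begin

text \<open>
  Write \<open>A t = t H + D\<close> and call \<open>y\<close> \<^emph>\<open>reachable\<close> from \<open>x\<close> if
  \<open>f x - f y \<in> A (\<gamma> d(x, y))\<close>. Conclusion (a) says that the point is reachable from \<open>x0\<close>, and (c)
  says that nothing else is reachable from it, so that a minimal element of a relation is sought.

  Convexity of \<open>H\<close> gives \<open>A s + A t \<subseteq> A (s + t)\<close>, and \<open>H \<subseteq> D\<close> makes \<open>A\<close> antitone. With the triangle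
  inequality this makes reachability transitive. It also makes every chain from \<open>x0\<close> short: along
  a finite chain of total length \<open>L\<close> the value of \<open>f\<close> drops by an element of \<open>A (\<gamma> L)\<close>, which is contained
  in \<open>A \<epsilon>\<close> as soon as \<open>\<epsilon> \<le> \<gamma> L\<close>, whereas drops in \<open>A \<epsilon>\<close> are excluded by the choice of \<open>x0\<close>. Hence
  \<open>L < \<epsilon> / \<gamma>\<close>, which also yields (b) for chains of one step.

  Being of finite length, an infinite chain from \<open>x0\<close> converges by completeness. The steps of
  the chain provide elements of \<open>H\<close> whose series, weighted by the lengths of the steps, sums to a multiple of an element of \<open>H\<close> because \<open>H\<close>
  is \<open>\<sigma>\<close>-convex; as \<open>D\<close> is closed, the inequalities for the partial sums survive in the limit, and
  submonotonicity replaces the values of \<open>f\<close> along the chain by the value at the limit. The weights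
  add up to at least the distance to the limit, so the limit is reachable from the whole
  chain (lemma \<open>mem_scaled_plus_cone_if_partial_sums\<close>). Minimality then comes from the usual greedy
  choice, in which every step has at least half the supremum of the possible lengths (lemma
  \<open>minimal_point_principle\<close>).
\<close>

section \<open>A minimal point principle in complete metric spaces\<close>

text \<open>
  A form of the Dancs-Hegedus-Medvegyev principle. The greedy chain has steps tending to zero, and
  twice the length of a step bounds the distance to every point that is still reachable; a point
  that remains reachable from the limit therefore is the limit.
\<close>

lemma minimal_point_principle:
  fixes R :: "'a::complete_space \<Rightarrow> 'a \<Rightarrow> bool"
  assumes refl: "\<And>x. R x x"
    and trans: "\<And>x y z. R x y \<Longrightarrow> R y z \<Longrightarrow> R x z"
    and bounded: "\<And>y. R a y \<Longrightarrow> dist a y \<le> r"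
    and summable: "\<And>s. s 0 = a \<Longrightarrow> (\<And>m n. n \<le> m \<Longrightarrow> R (s n) (s m)) \<Longrightarrow>
      summable (\<lambda>i. dist (s i) (s (Suc i)))"
    and limit: "\<And>s x. (\<And>m n. n \<le> m \<Longrightarrow> R (s n) (s m)) \<Longrightarrow>
      summable (\<lambda>i. dist (s i) (s (Suc i))) \<Longrightarrow> s \<longlonglongrightarrow> x \<Longrightarrow> R (s 0) x"
  shows "\<exists>x. R a x \<and> (\<forall>y. R x y \<longrightarrow> y = x)"
proof -
  have "\<exists>y. R x y \<and> (\<forall>z. R x z \<longrightarrow> dist x z \<le> 2 * dist x y)" if "R a x" for x
  proof -
    let ?B = "dist x ` {z. R x z}"
    have bdd: "bdd_above ?B"
    proof (rule bdd_aboveI2)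
      fix z assume "z \<in> {z. R x z}"
      then have "R a z" using trans that by blast
      then show "dist x z \<le> 2 * r"
        using bounded[OF that] bounded[of z] dist_triangle[of x z a] by (simp add: dist_commute)
    qed
    have upper: "dist x z \<le> Sup ?B" if "R x z" for z
      using bdd that by (intro cSup_upper) auto
    show ?thesis
    proof (cases "Sup ?B > 0")
      case True
      have "?B \<noteq> {}" using refl by blast
      with True bdd obtain y where "R x y" "Sup ?B / 2 < dist x y"
        using less_cSup_iff[of ?B "Sup ?B / 2"] by auto
      then show ?thesis using upper by (fastforce intro!: exI[of _ y])
    next
      case False
      then have "dist x z \<le> 2 * dist x x" if "R x z" for z
        using upper[OF that] by (simp only: dist_self)
      then show ?thesis using refl by blast
    qed
  qed
  then obtain g where g: "\<And>x. R a x \<Longrightarrow> R x (g x)"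
    and greedy: "\<And>x z. R a x \<Longrightarrow> R x z \<Longrightarrow> dist x z \<le> 2 * dist x (g x)"
    by metis
  define s where "s n = (g ^^ n) a" for n
  have s_simps: "s 0 = a" "\<And>n. s (Suc n) = g (s n)"
    by (simp_all add: s_def)
  have from_a: "R a (s n)" for n
    by (induction n) (use s_simps refl trans g in metis)+
  have chain: "R (s n) (s m)" if "n \<le> m" for n m
    using that by (induction rule: dec_induct) (use s_simps refl trans g from_a in metis)+
  have summable_s: "summable (\<lambda>i. dist (s i) (s (Suc i)))"
    using summable s_simps(1) chain by blast
  have "Cauchy s"
  proof (rule metric_CauchyI)
    fix e :: real assume "e > 0"
    then obtain N where N: "\<And>m n. m \<ge> N \<Longrightarrow> norm (\<Sum>i=m..<n. dist (s i) (s (Suc i))) < e / 2"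
      using summable_s[unfolded summable_Cauchy] half_gt_zero by metis
    have path: "dist (s N) (s n) \<le> (\<Sum>i=N..<n. dist (s i) (s (Suc i)))" if "N \<le> n" for n
      using that
    proof (induction rule: dec_induct)
      case (step n)
      then show ?case using dist_triangle[of "s N" "s (Suc n)" "s n"] by simp
    qed simp
    have "dist (s N) (s n) < e / 2" if "N \<le> n" for n
      using path[OF that] N[of N n] by simp
    then show "\<exists>M. \<forall>m\<ge>M. \<forall>n\<ge>M. dist (s m) (s n) < e"
      by (meson dist_triangle_half_r)
  qed
  then obtain x where x: "s \<longlonglongrightarrow> x"
    using Cauchy_convergent convergent_def by blast
  have to_x: "R (s n) x" for n
  proof -
    (* A tail of the chain is again a chain, so the hypothesis for the first point suffices. *)
    have "R (s (0 + n)) x"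
    proof (rule limit[of "\<lambda>k. s (k + n)"])
      show "summable (\<lambda>i. dist (s (i + n)) (s (Suc i + n)))"
        using summable_ignore_initial_segment[OF summable_s, of n] by simp
      show "(\<lambda>k. s (k + n)) \<longlonglongrightarrow> x"
        using x by (rule LIMSEQ_ignore_initial_segment)
    qed (auto intro: chain)
    then show ?thesis by simp
  qed
  show ?thesis
  proof (intro exI[of _ x] conjI allI impI)
    show "R a x" using to_x[of 0] by (simp add: s_simps)
    show "y = x" if "R x y" for y
    proof -
      have "dist (s n) y \<le> 2 * dist (s n) (s (Suc n))" for n
        using greedy[OF from_a trans[OF to_x that]] by (simp add: s_simps)
      then have "\<forall>\<^sub>F n in sequentially. norm (dist (s n) y) \<le> 2 * dist (s n) (s (Suc n))"
        by simp
      then have "(\<lambda>n. dist (s n) y) \<longlonglongrightarrow> 0"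
        by (rule Lim_null_comparison)
          (rule tendsto_mult_right_zero[OF summable_LIMSEQ_zero[OF summable_s]])
      then have "s \<longlonglongrightarrow> y" by (rule tendsto_dist_iff[THEN iffD2])
      then show "y = x" using x LIMSEQ_unique by blast
    qed
  qed
qed

section \<open>Scaled \<open>\<sigma>\<close>-convex sets plus a cone\<close>

text \<open>A convex combination is a series whose coefficients vanish from the third one on.\<close>

lemma sigma_convex_imp_convex:
  fixes B :: "'a::{real_vector, topological_space, t2_space} set"
  assumes "sigma_convex B"
  shows "convex B"
proof (rule convexI)
  fix x y :: 'a and u v :: real
  assume *: "x \<in> B" "y \<in> B" "0 \<le> u" "0 \<le> v" "u + v = 1"
  define b l where "b n = (if n = 0 then x else y)"
    and "l n = (if n = 0 then u else if n = 1 then v else 0)" for n :: nat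
  have "l sums (\<Sum>n<2. l n)" by (rule sums_finite) (auto simp: l_def)
  then have "l sums 1" using * by (simp add: l_def numeral_2_eq_2)
  moreover have "\<And>n. b n \<in> B" "\<And>n. 0 \<le> l n" using * by (auto simp: b_def l_def)
  ultimately obtain z where z: "z \<in> B" "(\<lambda>n. l n *\<^sub>R b n) sums z"
    using assms unfolding sigma_convex_def by blast
  have "(\<lambda>n. l n *\<^sub>R b n) sums (\<Sum>n<2. l n *\<^sub>R b n)"
    by (rule sums_finite) (auto simp: l_def)
  then have "z = u *\<^sub>R x + v *\<^sub>R y"
    using z(2) sums_unique2 by (fastforce simp: l_def b_def numeral_2_eq_2)
  then show "u *\<^sub>R x + v *\<^sub>R y \<in> B" using z by simp
qed

lemma scaled_plus_cone_add:
  assumes "convex H" "convex_cone D" "0 \<le> s" "0 \<le> t"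
    and "v \<in> (*\<^sub>R) s ` H + D" "w \<in> (*\<^sub>R) t ` H + D"
  shows "v + w \<in> (*\<^sub>R) (s + t) ` H + D"
proof -
  obtain h d where v: "h \<in> H" "d \<in> D" "v = s *\<^sub>R h + d"
    using assms(5) by (auto elim!: set_plus_elim)
  obtain k e where w: "k \<in> H" "e \<in> D" "w = t *\<^sub>R k + e"
    using assms(6) by (auto elim!: set_plus_elim)
  have "\<exists>g\<in>H. s *\<^sub>R h + t *\<^sub>R k = (s + t) *\<^sub>R g"
  proof (cases "s + t = 0")
    case True
    then show ?thesis using assms(3,4) v(1) by (intro bexI[of _ h]) (auto simp: add_nonneg_eq_0_iff)
  next
    case False
    let ?g = "(s / (s + t)) *\<^sub>R h + (t / (s + t)) *\<^sub>R k"
    have "?g \<in> H"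
      using False assms(1,3,4) v(1) w(1) by (intro convexD) (auto simp: add_divide_distrib[symmetric])
    moreover have "s *\<^sub>R h + t *\<^sub>R k = (s + t) *\<^sub>R ?g"
      using False by (simp add: scaleR_right_distrib)
    ultimately show ?thesis by blast
  qed
  then obtain g where g: "g \<in> H" "s *\<^sub>R h + t *\<^sub>R k = (s + t) *\<^sub>R g" by blast
  have "d + e \<in> D" using assms(2) v(2) w(2) by (simp add: convex_cone_add)
  moreover have "v + w = (s + t) *\<^sub>R g + (d + e)"
    using g(2) v(3) w(3) by (metis add.assoc add.left_commute)
  ultimately show ?thesis using g(1) by auto
qed

lemma scaled_plus_cone_antimono:
  assumes "convex_cone D" "H \<subseteq> D" "s \<le> t" "v \<in> (*\<^sub>R) t ` H + D"
  shows "v \<in> (*\<^sub>R) s ` H + D"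
proof -
  obtain h d where v: "h \<in> H" "d \<in> D" "v = t *\<^sub>R h + d"
    using assms(4) by (auto elim!: set_plus_elim)
  have "(t - s) *\<^sub>R h + d \<in> D"
    using assms v by (intro convex_cone_add convex_cone_scaleR) auto
  moreover have "v = s *\<^sub>R h + ((t - s) *\<^sub>R h + d)"
    using v(3) by (simp add: scaleR_left_diff_distrib)
  ultimately show ?thesis using v(1) by auto
qed

lemma scaled_plus_cone_subset:
  assumes "convex_cone D" "H \<subseteq> D" "0 \<le> t"
  shows "(*\<^sub>R) t ` H + D \<subseteq> D"
proof
  fix v assume "v \<in> (*\<^sub>R) t ` H + D"
  then obtain h d where v: "h \<in> H" "d \<in> D" "v = t *\<^sub>R h + d"
    by (auto elim!: set_plus_elim)
  then show "v \<in> D"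
    using assms by (simp add: convex_cone_add convex_cone_scaleR subset_iff)
qed

text \<open>
  This is the passage to the limit along a chain: \<open>w\<close> is the drop from the first point to the limit,
  and \<open>a i\<close> is the scaled length of a step. Dividing the coefficients by their sum, if that is
  positive, turns the series into a \<open>\<sigma>\<close>-convex combination, whose value lies in \<open>H\<close>; closedness of
  \<open>D\<close> carries the inequality for the partial sums over to the limit.
\<close>

lemma mem_scaled_plus_cone_if_partial_sums:
  fixes D H :: "'a::{real_vector, topological_group_add} set"
  assumes "closed D" "convex_cone D" "sigma_convex H"
    and h: "\<And>i. h i \<in> H" and a: "\<And>i. 0 \<le> a i" "a sums t"
    and partial: "\<And>n. w - (\<Sum>i<n. a i *\<^sub>R h i) \<in> D"
  shows "w \<in> (*\<^sub>R) t ` H + D"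
proof (cases "t = 0")
  case True
  have "w \<in> D" using partial[of 0] by simp
  then have "t *\<^sub>R h 0 + w \<in> (*\<^sub>R) t ` H + D"
    using h by (intro set_plus_intro imageI)
  then show ?thesis using True by simp
next
  case False
  have "0 \<le> t" using a sums_le[OF _ sums_zero a(2)] by simp
  with False have t: "t > 0" by simp
  have "(\<lambda>i. a i / t) sums 1" using sums_divide[OF a(2), of t] t by simp
  moreover have "\<forall>i. 0 \<le> a i / t" using a(1) t by simp
  ultimately obtain g where g: "g \<in> H" "(\<lambda>i. (a i / t) *\<^sub>R h i) sums g"
    using assms(3)[unfolded sigma_convex_def, THEN conjunct2, rule_format, of h "\<lambda>i. a i / t"] h
    by auto
  have "(1 / t) *\<^sub>R w - g \<in> D"
  proof (rule Lim_in_closed_set[OF assms(1)])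
    show "\<forall>\<^sub>F n in sequentially. (1 / t) *\<^sub>R w - (\<Sum>i<n. (a i / t) *\<^sub>R h i) \<in> D"
    proof (intro always_eventually allI)
      fix n
      have "(1 / t) *\<^sub>R (w - (\<Sum>i<n. a i *\<^sub>R h i)) \<in> D"
        using t by (intro convex_cone_scaleR[OF assms(2)] partial) auto
      then show "(1 / t) *\<^sub>R w - (\<Sum>i<n. (a i / t) *\<^sub>R h i) \<in> D"
        by (simp add: scaleR_right_diff_distrib scaleR_sum_right)
    qed
    show "(\<lambda>n. (1 / t) *\<^sub>R w - (\<Sum>i<n. (a i / t) *\<^sub>R h i)) \<longlonglongrightarrow> (1 / t) *\<^sub>R w - g"
      using g(2) unfolding sums_def by (intro tendsto_intros)
  qed simp
  then have "t *\<^sub>R ((1 / t) *\<^sub>R w - g) \<in> D"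
    using t by (intro convex_cone_scaleR[OF assms(2)]) auto
  then have "w - t *\<^sub>R g \<in> D" using t by (simp add: scaleR_right_diff_distrib)
  then have "t *\<^sub>R g + (w - t *\<^sub>R g) \<in> (*\<^sub>R) t ` H + D"
    using g(1) by (intro set_plus_intro imageI)
  then show ?thesis by simp
qed

section \<open>Ekeland's variational principle for maps into a topological vector space\<close>

theorem theorem5p1:
  fixes f :: "'x::complete_space \<Rightarrow> 'y::{real_topological_vector_space, t2_space}"
    and D H :: "'y set" and x0 :: 'x and \<epsilon> \<gamma> :: real
  assumes "closed D" and "convex_cone D"
    and "H \<subseteq> D" and "sigma_convex H"
    and "0 \<notin> vcl (H + D)"
    and "submonotone D f"
    and "\<epsilon> > 0"
    and "{f x0 - \<epsilon> *\<^sub>R h - d | h d. h \<in> H \<and> d \<in> D} \<inter> range f = {}"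
    and "\<gamma> > 0"
  shows "\<exists>x'.
    f x0 \<in> f x' +o ((*\<^sub>R) (\<gamma> * dist x0 x') ` H + D) \<and>
    dist x0 x' < \<epsilon> / \<gamma> \<and>
    (\<forall>x. x \<noteq> x' \<longrightarrow> f x' \<notin> f x +o ((*\<^sub>R) (\<gamma> * dist x' x) ` H + D))"
proof -
  define A where "A t = (*\<^sub>R) t ` H + D" for t
  define R where "R x y \<longleftrightarrow> f x - f y \<in> A (\<gamma> * dist x y)" for x y
  have mem_iff: "f x \<in> f y +o A t \<longleftrightarrow> f x - f y \<in> A t" for x y t
    by (auto simp: elt_set_plus_def algebra_simps intro: bexI[of _ "f x - f y"])
  have "convex H" using assms(4) by (rule sigma_convex_imp_convex)
  note A_add = scaled_plus_cone_add[OF this assms(2), folded A_def]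
  note A_anti = scaled_plus_cone_antimono[OF assms(2,3), folded A_def]
  note A_subset = scaled_plus_cone_subset[OF assms(2,3), folded A_def]
  have zero: "0 \<in> A 0"
  proof -
    obtain h where "h \<in> H" using assms(4) unfolding sigma_convex_def by blast
    then have "0 *\<^sub>R h + 0 \<in> A 0"
      unfolding A_def by (intro set_plus_intro imageI convex_cone_contains_0 assms(2))
    then show ?thesis by simp
  qed
  have drop_less: "t < \<epsilon>" if "f x0 - f y \<in> A t" for t y
  proof (rule ccontr)
    assume "\<not> t < \<epsilon>"
    then have "f x0 - f y \<in> A \<epsilon>" using A_anti[of \<epsilon> t] that by simp
    then obtain h d where "h \<in> H" "d \<in> D" "f x0 - f y = \<epsilon> *\<^sub>R h + d"
      unfolding A_def by (auto elim!: set_plus_elim)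
    moreover from this have "f y = f x0 - \<epsilon> *\<^sub>R h - d" by (simp add: algebra_simps)
    ultimately show False using assms(8) by blast
  qed
  have R_refl: "R x x" for x using zero by (simp add: R_def)
  have R_trans: "R x z" if "R x y" "R y z" for x y z
  proof -
    have "f x - f y + (f y - f z) \<in> A (\<gamma> * dist x y + \<gamma> * dist y z)"
      using that assms(9) unfolding R_def by (intro A_add) auto
    moreover have "\<gamma> * dist x z \<le> \<gamma> * dist x y + \<gamma> * dist y z"
      using assms(9) dist_triangle[of x z y] by (simp flip: distrib_left)
    ultimately show ?thesis unfolding R_def using A_anti by simp
  qed
  have R_dist: "dist x0 y < \<epsilon> / \<gamma>" if "R x0 y" for y
    using drop_less[OF that[unfolded R_def]] assms(9) by (simp add: field_simps)
  have "\<exists>x'. R x0 x' \<and> (\<forall>y. R x' y \<longrightarrow> y = x')"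
  proof (rule minimal_point_principle[of R x0 "\<epsilon> / \<gamma>", OF R_refl R_trans])
    fix s :: "nat \<Rightarrow> 'x"
    assume s0: "s 0 = x0" and chain: "\<And>m n. n \<le> m \<Longrightarrow> R (s n) (s m)"
    have drop: "f x0 - f (s n) \<in> A (\<gamma> * (\<Sum>i<n. dist (s i) (s (Suc i))))" for n
    proof (induction n)
      case 0
      then show ?case using zero by (simp add: s0)
    next
      case (Suc n)
      have "f x0 - f (s n) + (f (s n) - f (s (Suc n)))
          \<in> A (\<gamma> * (\<Sum>i<n. dist (s i) (s (Suc i))) + \<gamma> * dist (s n) (s (Suc n)))"
        using Suc chain[of n "Suc n"] assms(9) unfolding R_def
        by (intro A_add) (auto intro!: mult_nonneg_nonneg sum_nonneg)
      then show ?case by (simp add: distrib_left)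
    qed
    show "summable (\<lambda>i. dist (s i) (s (Suc i)))"
    proof (rule summableI_nonneg_bounded)
      show "(\<Sum>i<n. dist (s i) (s (Suc i))) \<le> \<epsilon> / \<gamma>" for n
        using drop_less[OF drop[of n]] assms(9) by (simp add: field_simps)
    qed simp
  next
    fix s :: "nat \<Rightarrow> 'x" and x
    assume chain: "\<And>m n. n \<le> m \<Longrightarrow> R (s n) (s m)"
      and summable: "summable (\<lambda>i. dist (s i) (s (Suc i)))" and lim: "s \<longlonglongrightarrow> x"
    define L where "L = (\<Sum>i. dist (s i) (s (Suc i)))"
    have "\<exists>h d. h \<in> H \<and> d \<in> D \<and> f (s i) - f (s (Suc i)) = (\<gamma> * dist (s i) (s (Suc i))) *\<^sub>R h + d" for i
      using chain[of i "Suc i"] unfolding R_def A_def by (auto elim!: set_plus_elim)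
    then obtain h d where h: "\<And>i. h i \<in> H" and d: "\<And>i. d i \<in> D"
      and step: "\<And>i. f (s i) - f (s (Suc i)) = (\<gamma> * dist (s i) (s (Suc i))) *\<^sub>R h i + d i"
      by metis
    have "cone_le D (f (s m)) (f (s n))" if "n < m" for m n
    proof -
      have "f (s n) - f (s m) \<in> D"
        using A_subset[of "\<gamma> * dist (s n) (s m)"] chain[of n m] that assms(9)
        unfolding R_def by auto
      then show ?thesis unfolding cone_le_def by (force intro: image_eqI[of _ _ "f (s n) - f (s m)"])
    qed
    then have "cone_le D (f x) (f (s n))" for n
      using assms(6) lim unfolding submonotone_def by blast
    then have f_lim: "f (s n) - f x \<in> D" for n
      unfolding cone_le_def by (metis imageE minus_diff_eq minus_minus)
    have partial: "f (s 0) - f (s n) - (\<Sum>i<n. (\<gamma> * dist (s i) (s (Suc i))) *\<^sub>R h i) \<in> D" for n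
    proof (induction n)
      case 0
      then show ?case using assms(2) by (simp add: convex_cone_contains_0)
    next
      case (Suc n)
      then show ?case
        using convex_cone_add[OF assms(2) Suc d[of n]] step[of n] by (simp add: algebra_simps)
    qed
    have "f (s 0) - f x - (\<Sum>i<n. (\<gamma> * dist (s i) (s (Suc i))) *\<^sub>R h i) \<in> D" for n
      using convex_cone_add[OF assms(2) partial[of n] f_lim[of n]] by (simp add: algebra_simps)
    moreover have "(\<lambda>i. \<gamma> * dist (s i) (s (Suc i))) sums (\<gamma> * L)"
      unfolding L_def using summable by (intro sums_mult summable_sums)
    ultimately have "f (s 0) - f x \<in> A (\<gamma> * L)"
      unfolding A_def using assms(9) h
      by (intro mem_scaled_plus_cone_if_partial_sums[OF assms(1,2,4),
            where a = "\<lambda>i. \<gamma> * dist (s i) (s (Suc i))" and h = h]) auto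
    moreover have "dist (s 0) x \<le> L"
    proof (rule LIMSEQ_le_const2)
      show "(\<lambda>n. dist (s 0) (s n)) \<longlonglongrightarrow> dist (s 0) x"
        using lim by (intro tendsto_intros)
      have "dist (s 0) (s n) \<le> L" for n
      proof -
        have "dist (s 0) (s n) \<le> (\<Sum>i<n. dist (s i) (s (Suc i)))"
        proof (induction n)
          case (Suc n)
          then show ?case using dist_triangle[of "s 0" "s (Suc n)" "s n"] by simp
        qed simp
        also have "\<dots> \<le> L" unfolding L_def using summable by (intro sum_le_suminf) auto
        finally show ?thesis .
      qed
      then show "\<exists>N. \<forall>n\<ge>N. dist (s 0) (s n) \<le> L" by blast
    qed
    ultimately show "R (s 0) x"
      unfolding R_def using A_anti[of "\<gamma> * dist (s 0) x" "\<gamma> * L"] assms(9) by simp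
  next
    show "dist x0 y \<le> \<epsilon> / \<gamma>" if "R x0 y" for y
      using R_dist[OF that] by simp
  qed
  then show ?thesis
    unfolding A_def[symmetric] mem_iff R_def[symmetric] using R_dist by blast
qed

end
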